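(* Let $a_2,a_3$ be integers with $1<a_2<a_3$, $A=\{1,a_2,a_3\}$, and let $h$ be a positive integer with $X(h)\ge a_3$. Then for every integer $x$ with $X(h)<x<ha_3$: $x$ has no $h$-representation if and only if $x+a_3$ has no $(h+1)$-representation.
   Context: An integer $x$ has an $h$-representation if $x=c_3a_3+c_2a_2+c_1$ with integers $c_1,c_2,c_3\ge0$ and $c_1+c_2+c_3\le h$. $X(h)$ is one less than the smallest positive integer with no $h$-representation. *)

theory Defs
  imports Main
begin

definition has_rep :: "int \<Rightarrow> int \<Rightarrow> nat \<Rightarrow> int \<Rightarrow> bool" where
  "has_rep a2 a3 h x \<longleftrightarrow>
     (\<exists>c1 c2 c3 :: int. c1 \<ge> 0 \<and> c2 \<ge> 0 \<and> c3 \<ge> 0 \<and> c1 + c2 + c3 \<le> int h \<and>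
        x = c3 * a3 + c2 * a2 + c1)"

definition Xh :: "int \<Rightarrow> int \<Rightarrow> nat \<Rightarrow> int" where
  "Xh a2 a3 h = (LEAST n::int. n > 0 \<and> \<not> has_rep a2 a3 h n) - 1"

end

(* Only a representation x + a3 = c2 a2 + c1 without a3 is problematic. Put p = a2 - 1 and
   a3 - 1 = q p + t with q = a3 div a2; X(h) >= a3 forces h + 1 >= q + p. Since a sum with k terms a3
   and j terms a2 exceeds its number of terms by k (a3 - 1) + j p, exchanging k q + w terms a2 for k
   terms a3 changes this excess by k t - w p, and one has to find k > 0 and w such that the excess
   stays large enough while the sum does not become too large. If every k fails with
   w = (e + k t) div p, then the intervals [g k, f k] below lie in a window of bounded size and no
   interval is contained in a later one; counting endpoints to the left and to the right of the
   last interval shows that there are too few of them. *)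
theory Submission
  imports Defs
begin

text \<open>Here \<open>j\<close> copies of a2 have excess \<open>j * p\<close>, which overshoots
  the required excess by \<open>e\<close>. After the exchange the overshoot is
  \<open>e + k * t - w * p\<close>, and \<open>j - k * q - w\<close> copies of a2 remain. The last
  inequality says that the terms a2 and a3 together do not exceed the target sum.\<close>

lemma exists_exchange:
  fixes p t q e j T :: int
  assumes t: "0 \<le> t" "t < p" and q: "1 \<le> q" and e: "0 \<le> e" "e < p"
    and j: "q + 1 \<le> j" and T: "e + j \<le> T" "q + p \<le> T"
  shows "\<exists>k w. 1 \<le> k \<and> 0 \<le> w \<and> k * q + w \<le> j \<and> 0 \<le> e + k * t - w * p
           \<and> e + k * t - w * p + k + (j - k * q - w) \<le> T"
proof (rule ccontr)
  assume none: "\<not> ?thesis"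
  have p: "0 < p" using t by linarith
  \<comment> \<open>\<open>w k\<close> is the largest w that leaves a nonnegative overshoot, and
    \<open>f k\<close> is that overshoot. With this choice the last inequality reads
    \<open>g k + j \<le> T\<close>.\<close>
  define w where "w k = (e + k * t) div p" for k
  define f where "f k = (e + k * t) mod p" for k
  define g where "g k = f k - w k - k * (q - 1)" for k
  have f_eq: "f k = e + k * t - w k * p" for k
    by (simp add: f_def w_def minus_div_mult_eq_mod)
  have f_range: "0 \<le> f k" "f k \<le> p - 1" for k
    using p by (simp_all add: f_def)
  have w_mono: "w k \<le> w l" if "k \<le> l" for k l
    unfolding w_def using that t p by (intro zdiv_mono1) (auto intro: mult_right_mono)
  have w_nonneg: "0 \<le> w k" if "0 \<le> k" for k
    unfolding w_def using that t e p by (simp add: pos_imp_zdiv_nonneg_iff)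
  have w_Suc: "w (k + 1) \<le> w k + 1" for k
  proof -
    have "w (k + 1) \<le> (e + k * t + p) div p"
      unfolding w_def using t p by (intro zdiv_mono1) (auto simp: algebra_simps)
    moreover have "(e + k * t + p) div p = w k + 1"
      unfolding w_def using p by (intro div_add_self2) simp
    ultimately show ?thesis by simp
  qed
  define M where "M = {k. 1 \<le> k \<and> k * q + w k \<le> j}"
  have "M \<subseteq> {1..j}"
  proof
    fix k assume "k \<in> M"
    then have k: "1 \<le> k" "k * q + w k \<le> j" by (auto simp: M_def)
    have "k * 1 \<le> k * q" using k q by (intro mult_left_mono) auto
    then have "k \<le> j" using k w_nonneg[of k] by linarith
    then show "k \<in> {1..j}" using k by simp
  qed
  then have fin: "finite M" by (rule finite_subset) simp
  have "w 1 \<le> 1" using w_Suc[of 0] e by (simp add: w_def)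
  then have "1 \<in> M" using j by (simp add: M_def)
  define m where "m = Max M"
  have "m \<in> M" unfolding m_def using fin \<open>1 \<in> M\<close> by (intro Max_in) auto
  then have m: "1 \<le> m" "m * q + w m \<le> j" by (auto simp: M_def)
  have "m + 1 \<notin> M"
    using Max_ge[OF fin, of "m + 1"] by (auto simp: m_def)
  then have "j + 1 \<le> (m + 1) * q + w (m + 1)" using m by (simp add: M_def)
  then have m_large: "j \<le> m * q + q + w m" using w_Suc[of m] by (simp add: algebra_simps)
  have in_M: "k * q + w k \<le> j" if "k \<le> m" for k
  proof -
    have "k * q \<le> m * q" using that q by (intro mult_right_mono) auto
    then show ?thesis using m w_mono[OF that] by linarith
  qed
  have g_ge: "q + p - j + 1 \<le> g k" if "1 \<le> k" "k \<le> m" for k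
  proof -
    have "\<not> e + k * t - w k * p + k + (j - k * q - w k) \<le> T"
      using none that w_nonneg[of k] in_M[of k] f_range(1)[of k] f_eq[of k] by fastforce
    then show ?thesis using T f_eq[of k] by (simp add: g_def algebra_simps)
  qed
  \<comment> \<open>Exchanging for \<open>l - k\<close> terms a3 with parameter
    \<open>w l - w k\<close> gives overshoot \<open>e + f l - f k\<close>, and the left side of the
    last inequality becomes \<open>e + j + g l - g k\<close>, which is at most
    \<open>e + j\<close>.\<close>
  have no_nest: False if "1 \<le> k" "k < l" "l \<le> m" "f k \<le> f l" "g l \<le> g k" for k l
  proof -
    have 1: "0 \<le> w l - w k" using w_mono[of k l] that by simp
    have 2: "(l - k) * q + (w l - w k) \<le> j"
    proof -
      have "0 \<le> k * q" using that q by simp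
      then show ?thesis using in_M[of l] that w_nonneg[of k] by (simp add: algebra_simps)
    qed
    have 3: "0 \<le> e + (l - k) * t - (w l - w k) * p"
      using that(4) f_eq[of k] f_eq[of l] e by (simp add: algebra_simps)
    have 4: "e + (l - k) * t - (w l - w k) * p + (l - k) + (j - (l - k) * q - (w l - w k)) \<le> T"
      using that(5) f_eq[of k] f_eq[of l] T unfolding g_def by (simp add: algebra_simps)
    show False using none 1 2 3 4 that by fastforce
  qed
  have len: "f k - g k \<le> f l - g l" if "k \<le> l" for k l
  proof -
    have "k * (q - 1) \<le> l * (q - 1)" using that q by (intro mult_right_mono) auto
    then show ?thesis using w_mono[OF that] by (simp add: g_def)
  qed
  \<comment> \<open>Right endpoints are counted on \<open>U\<close>, left endpoints on
    \<open>L\<close>. Interval lengths never decrease, so two equal endpoints of the same kind would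
    give a forbidden nesting.\<close>
  define U where "U = {k \<in> {1..<m}. f m < f k}"
  define L where "L = {k \<in> {1..<m}. \<not> f m < f k}"
  have inj_f: "inj_on f U"
  proof (rule linorder_inj_onI)
    fix k l assume "k < l" "k \<in> U" "l \<in> U"
    then show "f k \<noteq> f l" using no_nest[of k l] len[of k l] by (auto simp: U_def)
  qed auto
  have inj_g: "inj_on g L"
  proof (rule linorder_inj_onI)
    fix k l assume "k < l" "k \<in> L" "l \<in> L"
    then show "g k \<noteq> g l" using no_nest[of k l] len[of k l] by (auto simp: L_def)
  qed auto
  have "f ` U \<subseteq> {f m<..p - 1}" using f_range by (auto simp: U_def)
  then have "card U \<le> card {f m<..p - 1}" using inj_f by (intro card_inj_on_le) auto
  then have U: "int (card U) \<le> p - 1 - f m" using f_range[of m] by simp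
  have "g ` L \<subseteq> {q + p - j + 1..<g m}"
  proof
    fix y assume "y \<in> g ` L"
    then obtain k where k: "y = g k" "1 \<le> k" "k < m" "f k \<le> f m" by (auto simp: L_def)
    then show "y \<in> {q + p - j + 1..<g m}" using g_ge[of k] no_nest[of k m] by force
  qed
  then have "card L \<le> card {q + p - j + 1..<g m}" using inj_g by (intro card_inj_on_le) auto
  then have L: "int (card L) \<le> g m - (q + p - j + 1)" using g_ge[of m] m by simp
  have "U \<union> L = {1..<m}" "U \<inter> L = {}" by (auto simp: U_def L_def)
  moreover from this have "finite U" "finite L"
    by (metis finite_Un finite_atLeastLessThan_int)+
  ultimately have "card U + card L = card {1..<m}" by (metis card_Un_disjoint)
  then have "int (card U) + int (card L) = m - 1" using m by simp
  \<comment> \<open>The two counts add up to \<open>m * q + q + w m + 1 \<le> j\<close>, contrary to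
    the maximality of \<open>m\<close>.\<close>
  then show False using U L m_large by (simp add: g_def algebra_simps)
qed

text \<open>The integers are not well-ordered, so the minimum behind \<open>LEAST\<close> is first
  found among the natural numbers.\<close>

lemma Xh_less:
  assumes "0 < n" and "\<not> has_rep a2 a3 h n"
  shows "Xh a2 a3 h < n"
proof -
  define P where "P n \<longleftrightarrow> 0 < n \<and> \<not> has_rep a2 a3 h n" for n
  define N where "N = (LEAST k. P (int k))"
  have "P n" using assms by (simp add: P_def)
  then have "P (int (nat n))" using assms by simp
  then have N: "P (int N)" unfolding N_def by (rule LeastI)
  have N_le: "int N \<le> k" if "P k" for k
  proof -
    have "0 < k" using that by (simp add: P_def)
    then have "N \<le> nat k" unfolding N_def using that by (intro Least_le) simp
    then show ?thesis using \<open>0 < k\<close> by linarith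
  qed
  have "(LEAST n. P n) = int N" using N N_le by (rule Least_equality)
  then have "Xh a2 a3 h = int N - 1" by (simp add: Xh_def P_def)
  then show ?thesis using N_le[OF \<open>P n\<close>] by simp
qed

text \<open>The test value is \<open>q * a2 - 1\<close> with \<open>q = a3 div a2\<close>. It is
  positive and below a3, so it is represented without a3 and with at most \<open>q - 1\<close> terms
  a2, which forces at least \<open>q + a2 - 2\<close> terms in all.\<close>

lemma Xh_ge_imp_h_ge:
  assumes "1 < a2" "a2 < a3" and X: "a3 \<le> Xh a2 a3 h"
  shows "a3 div a2 + (a2 - 1) \<le> int h + 1"
proof -
  define q where "q = a3 div a2"
  have "0 \<le> a3 mod a2" using assms by simp
  then have qa: "q * a2 \<le> a3" unfolding q_def using div_mult_mod_eq[of a3 a2] by linarith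
  have q: "1 \<le> q" unfolding q_def using assms by (simp add: pos_imp_zdiv_pos_iff int_one_le_iff_zero_less)
  have "1 * a2 \<le> q * a2" using q assms by (intro mult_right_mono) auto
  then have "0 < q * a2 - 1" "q * a2 - 1 < a3" using qa assms by linarith+
  then have "has_rep a2 a3 h (q * a2 - 1)"
    using Xh_less[of "q * a2 - 1" a2 a3 h] X by fastforce
  then obtain c1 c2 c3 where c: "0 \<le> c1" "0 \<le> c2" "0 \<le> c3" "c1 + c2 + c3 \<le> int h"
    "q * a2 - 1 = c3 * a3 + c2 * a2 + c1" by (auto simp: has_rep_def)
  have c2: "0 \<le> c2 * a2" using c assms by simp
  have "c3 < 1"
  proof (rule ccontr)
    assume "\<not> c3 < 1"
    then have "1 * a3 \<le> c3 * a3" using assms by (intro mult_right_mono) auto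
    then show False using c c2 qa by linarith
  qed
  then have "c3 = 0" using c by simp
  then have eq: "q * a2 - 1 = c2 * a2 + c1" using c by simp
  then have "c2 * a2 < q * a2" using c by linarith
  then have "c2 < q" using assms by (simp add: mult_less_cancel_right)
  then have "c2 * (a2 - 1) \<le> (q - 1) * (a2 - 1)" using assms by (intro mult_right_mono) auto
  then show ?thesis using eq c \<open>c3 = 0\<close> unfolding q_def[symmetric] by (simp add: algebra_simps)
qed

lemma has_rep_add_a3:
  assumes "has_rep a2 a3 h x"
  shows "has_rep a2 a3 (h + 1) (x + a3)"
proof -
  obtain c1 c2 c3 where "0 \<le> c1" "0 \<le> c2" "0 \<le> c3" "c1 + c2 + c3 \<le> int h"
    "x = c3 * a3 + c2 * a2 + c1" using assms by (auto simp: has_rep_def)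
  then show ?thesis unfolding has_rep_def
    by (intro exI[of _ c1] exI[of _ c2] exI[of _ "c3 + 1"]) (simp add: algebra_simps)
qed

lemma has_rep_diff_a3:
  assumes a: "1 < a2" "a2 < a3" and h: "a3 div a2 + (a2 - 1) \<le> int h + 1"
    and x: "0 \<le> x" and rep: "has_rep a2 a3 (h + 1) (x + a3)"
  shows "has_rep a2 a3 h x"
proof -
  obtain c1 c2 c3 where c: "0 \<le> c1" "0 \<le> c2" "0 \<le> c3" "c1 + c2 + c3 \<le> int h + 1"
    "x + a3 = c3 * a3 + c2 * a2 + c1" using rep by (auto simp: has_rep_def)
  define p where "p = a2 - 1"
  define q where "q = a3 div a2"
  define t where "t = a3 - 1 - q * p"
  define T where "T = int h + 1"
  \<comment> \<open>Terms 1 have excess 0, so terms a2 and a3 with sum at most \<open>x + a3\<close>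
    can be filled up by ones within \<open>T\<close> terms exactly when their excess is at least
    \<open>d\<close>.\<close>
  define d where "d = x + a3 - T"
  have p: "0 < p" using a by (simp add: p_def)
  have q: "1 \<le> q" unfolding q_def using a by (simp add: pos_imp_zdiv_pos_iff int_one_le_iff_zero_less)
  have r: "t = q - 1 + a3 mod a2"
    using div_mult_mod_eq[of a3 a2] by (simp add: t_def p_def q_def algebra_simps)
  have "0 \<le> a3 mod a2" "a3 mod a2 \<le> a2 - 1" using a by (simp_all add: zle_diff1_eq)
  then have t: "0 \<le> t" "t - p \<le> q" using r q p_def by linarith+
  show ?thesis
  proof (cases "c3 = 0")
    case False
    then show ?thesis unfolding has_rep_def using c
      by (intro exI[of _ c1] exI[of _ c2] exI[of _ "c3 - 1"]) (simp add: algebra_simps)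
  next
    case c3: True
    show ?thesis
    proof (cases "d \<le> q * p")
      case True
      \<comment> \<open>Indeed \<open>x = d + T - a3\<close> is at most \<open>h - t\<close>, so
        ones alone suffice.\<close>
      then have "x \<le> int h" using t by (simp add: d_def T_def t_def)
      then show ?thesis unfolding has_rep_def using x
        by (intro exI[of _ x] exI[of _ 0]) simp
    next
      case False
      \<comment> \<open>This is d / p rounded up: the least number of terms a2 whose excess reaches
        \<open>d\<close>. Its overshoot \<open>e\<close> is therefore below \<open>p\<close>, which
        \<open>c2\<close> itself would not ensure.\<close>
      define j where "j = - ((- d) div p)"
      define e where "e = (- d) mod p"
      have e: "0 \<le> e" "e < p" using p by (simp_all add: e_def)
      have jd: "j * p = d + e"
        using minus_mod_eq_div_mult[of "- d" p] unfolding j_def e_def by linarith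
      have "q * p < j * p" using False jd e by linarith
      then have j: "q + 1 \<le> j" using p by (simp add: mult_less_cancel_right)
      have "d \<le> c2 * p" using c c3 by (simp add: d_def T_def p_def algebra_simps)
      then have "j * p < (c2 + 1) * p" using jd e by (simp add: algebra_simps)
      then have "j \<le> c2" using p by (simp add: mult_less_cancel_right)
      then have "j * a2 \<le> c2 * a2" using a by (intro mult_right_mono) auto
      \<comment> \<open>Both sides are shifted by \<open>d\<close>:
        \<open>j * a2 = d + e + j\<close> and \<open>x + a3 = d + T\<close>.\<close>
      then have T: "e + j \<le> T" using jd c c3 by (simp add: d_def T_def p_def algebra_simps)
      have "\<exists>k w. 1 \<le> k \<and> 0 \<le> w \<and> k * q + w \<le> j \<and> 0 \<le> e + k * t - w * p
           \<and> e + k * t - w * p + k + (j - k * q - w) \<le> T"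
      proof (cases "t < p")
        case True
        then show ?thesis using exists_exchange[of t p q e j T] t q e j T h
          by (simp add: T_def p_def q_def)
      next
        case False
        \<comment> \<open>Both witnesses are 1: the left side is \<open>e + j + (t - p) - q\<close>,
          and \<open>t - p \<le> q\<close>.\<close>
        then show ?thesis using t e j T
          by (intro exI[of _ 1]) simp
      qed
      then obtain k w where kw: "1 \<le> k" "k * q + w \<le> j" "0 \<le> e + k * t - w * p"
        "e + k * t - w * p + k + (j - k * q - w) \<le> T" by blast
      define i where "i = j - k * q - w"
      define f where "f = e + k * t - w * p"
      have "k * (a3 - 1) + i * p = d + f"
        using jd by (simp add: i_def f_def t_def algebra_simps)
      then have "x = (k - 1) * a3 + i * a2 + (T - f - k - i)"
        by (simp add: d_def p_def algebra_simps)
      then show ?thesis unfolding has_rep_def using kw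
        by (intro exI[of _ "T - f - k - i"] exI[of _ i] exI[of _ "k - 1"])
          (simp add: i_def f_def T_def)
    qed
  qed
qed

theorem theorem4:
  fixes a2 a3 :: int and h :: nat and x :: int
  assumes "1 < a2" and "a2 < a3" and "h > 0"
    and "Xh a2 a3 h \<ge> a3"
    and "Xh a2 a3 h < x" and "x < int h * a3"
  shows "\<not> has_rep a2 a3 h x \<longleftrightarrow> \<not> has_rep a2 a3 (h + 1) (x + a3)"
  using has_rep_add_a3 has_rep_diff_a3[OF assms(1,2) Xh_ge_imp_h_ge] assms by auto

end
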